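(* Let $f,g_1,\dots,g_s\in\mathbb{R}[x_1,\dots,x_n]$, let $\mathbf{g}=(g_1,\dots,g_s)$, let $f_0=f(0)$ be the constant term of $f$, and for $\mu=(\mu_1,\dots,\mu_s)\in[0,\infty)^s$ let $h(\mu)=f-\sum_{j=1}^s\mu_jg_j$. Let $\gamma$ be the optimal value of the optimization problem (P) described in the context, and let $s(f,\mathbf{g})=\sup\{h(\mu)_{\mathrm{gp}}:\mu\in[0,\infty)^s\}$. Then $f_0-\gamma\leq s(f,\mathbf{g})$.
   Context: Notation: $\mathbb{N}$ contains $0$; $x^\alpha = x_1^{\alpha_1}\cdots x_n^{\alpha_n}$; $\mathrm{New}(p)$ is the Newton polytope of $p$. Infima and suprema are in $\mathbb{R}\cup\{\pm\infty\}$. For any polynomial $p$, $\Delta(p)$ is the set of exponents $\alpha$ of $p$ not defining a monomial square, i.e. $p_\alpha<0$, or $\alpha\notin(2\mathbb{N})^n$ and $p_\alpha>0$. ST-polynomials. An ST-polynomial in standard form is a polynomial $p = p_{\alpha(0)}+\sum_{j=1}^n p_{\alpha(j)} x^{\alpha(j)} +\sum_{\alpha \in \Delta(p)} p_\alpha x^\alpha$ such that: (ST1) $\alpha(0)=0$ and $\alpha(1),\ldots,\alpha(n)$ form a set $V$ of affinely independent points in $(2\mathbb{N})^n$; (ST2) $\Delta(p)$ is as just defined; (ST3) $\Delta(p)\subseteq \mathrm{conv}(V)$, so every $\alpha\in\Delta(p)$ is uniquely $\alpha=\sum_{j=0}^n\lambda_j^{(\alpha)}\alpha(j)$ with $\lambda_j^{(\alpha)}\ge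 0$, $\sum_j\lambda_j^{(\alpha)}=1$; (ST4) $p_{\alpha(0)},\ldots,p_{\alpha(n)}\ge0$, and if $p_{\alpha(j)}=0$ then $\lambda_j^{(\alpha)}=0$ for all $\alpha\in\Delta(p)$. Put $\mathrm{nz}(\alpha)=\{j\in\{0,\ldots,n\}:\lambda_j^{(\alpha)}\neq 0\}$. The bound $p_{\mathrm{gp}}$. For an ST-polynomial $p$, $p_{\mathrm{gp}}$ is the supremum of all $r\in\mathbb{R}$ for which there exist reals $a_{\alpha,j}\ge 0$, $(\alpha,j)\in\Delta(p)\times\{1,\dots,n\}$, with: $a_{\alpha,j}>0$ whenever $\lambda_j^{(\alpha)}>0$; $|p_\alpha| \leq \prod_{j\in \mathrm{nz}(\alpha), j\geq 1} (a_{\alpha,j}/\lambda_j^{(\alpha)})^{\lambda_j^{(\alpha)}}$ for every $\alpha\in\Delta(p)$ with $\lambda_0^{(\alpha)}=0$; $p_{\alpha(j)}\ge\sum_{\alpha\in\Delta(p)}a_{\alpha,j}$ for $j=1,\dots,n$; and $p(0)-r \geq \sum_{\alpha \in \Delta(p), 0 \in \mathrm{nz}(\alpha)} \lambda_0^{(\alpha)} |p_\alpha|^{1/\lambda_0^{(\alpha)}} \prod_{j\in \mathrm{nz}(\alpha), j\geq 1} (\lambda_j^{(\alpha)}/a_{\alpha,j})^{\lambda_j^{(\alpha)}/\lambda_0^{(\alpha)}}$. One sets $h(\mu)_{\mathrm{gp}}=-\infty$ if $h(\mu)$ is not an ST-polynomial with $\mathrm{New}(h(\mu))$ a simplex with even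 vertex set $\{0,\alpha(1),\dots,\alpha(n)\}\subset(2\mathbb{N})^n$. Problem (P). Let $\Delta(h)=\Delta(f)\cup\Delta(-g_1)\cup\dots\cup\Delta(-g_s)$; then $\Delta(h(\mu))\subseteq\Delta(h)$ for all $\mu$. Only those $\mu$ are admissible for which $h(\mu)$ is an ST-polynomial with $\mathrm{New}(h(\mu))$ a simplex with even vertices $\alpha(0)=0,\alpha(1),\dots,\alpha(n)$. For such $\mu$, $\lambda_0^{(\alpha,\mu)},\dots,\lambda_n^{(\alpha,\mu)}$ are the barycentric coordinates of $\alpha\in\mathrm{New}(h(\mu))\cap\mathbb{N}^n$ with respect to these vertices, $\mathrm{nz}(\alpha)=\{j:\lambda_j^{(\alpha,\mu)}\ne0\}$, and $h(\mu)_\alpha$ is the coefficient of $x^\alpha$ in $h(\mu)$. Terms and constraints below involving $\lambda_j^{(\alpha,\mu)}$ are understood only for those $\alpha\in\Delta(h)$ that lie in $\mathrm{New}(h(\mu))$. The variables are $\mu\in[0,\infty)^s$ and, for every $\alpha\in\Delta(h)$, $\mathbf{a}_\alpha=(a_{\alpha,1},\dots,a_{\alpha,n})\in\mathbb{R}_{>0}^n$ and $b_\alpha\in\mathbb{R}_{\ge0}$. Problem (P) is to minimize $$p(\mu,\{(\mathbf{a}_\alpha,b_\alpha)\})=\sum_{j=1}^{s} \mu_jg_j(0) + \sum_{\alpha \in \Delta(h),\ \lambda_0^{(\alpha,\mu)} \neq 0} \lambda_0^{(\alpha,\mu)} \, b_{\alpha}^{1/\lambda_0^{(\alpha,\mu)}}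 \prod_{j\in \mathrm{nz}(\alpha),\, j\geq 1} \left(\frac{\lambda_j^{(\alpha,\mu)}}{a_{\alpha,j}}\right)^{\lambda_j^{(\alpha,\mu)}/\lambda_0^{(\alpha,\mu)}}$$ subject to (1) $\sum_{\alpha\in\Delta(h)} a_{\alpha,j} \leq h(\mu)_{\alpha(j)}$ for all $1\le j\le n$; (2) $\prod_{j\in \mathrm{nz}(\alpha),\, j\geq 1} \left(a_{\alpha,j}/\lambda_j^{(\alpha,\mu)}\right)^{\lambda_j^{(\alpha,\mu)}} \geq |h(\mu)_{\alpha}|$ for every $\alpha\in\Delta(h)$ with $\lambda_0^{(\alpha,\mu)}=0$; (3) $|h(\mu)_{\alpha}| \leq b_\alpha$ for every $\alpha\in\Delta(h)$ with $\lambda_0^{(\alpha,\mu)}\neq 0$. Its optimal value is the infimum of the objective over feasible points ($+\infty$ if infeasible). *)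

theory Defs
  imports "HOL-Analysis.Analysis" "HOL-Library.Poly_Mapping"
begin

text \<open>
  The ring of real polynomials in \<open>n\<close> variables is rendered as the ring of finitely supported maps
  from exponent vectors to coefficients, where \<open>n = CARD('n)\<close>. The coefficient of
  \<open>x\<^sup>\<alpha>\<close> in \<open>p\<close> is \<open>lookup p \<alpha>\<close>, and multiplication is convolution.
\<close>

type_synonym 'n expo = "nat ^ 'n"
type_synonym 'n rpoly = "(nat ^ 'n) \<Rightarrow>\<^sub>0 real"

abbreviation coeff :: "'n::finite rpoly \<Rightarrow> 'n expo \<Rightarrow> real" where
  "coeff \<equiv> Poly_Mapping.lookup"

abbreviation const :: "real \<Rightarrow> 'n::finite rpoly" where
  "const c \<equiv> Poly_Mapping.single 0 c"

definition eval_poly :: "'n::finite rpoly \<Rightarrow> real ^ 'n \<Rightarrow> real" where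
  "eval_poly p x = (\<Sum>\<alpha>\<in>Poly_Mapping.keys p. coeff p \<alpha> * (\<Prod>i\<in>UNIV. (x $ i) ^ (\<alpha> $ i)))"

lemma eval_poly_0: "eval_poly p 0 = coeff p (0 :: 'n::finite expo)"
proof -
  have *: "(\<Prod>i\<in>UNIV. ((0 :: real ^ 'n) $ i) ^ (\<alpha> $ i)) = (if \<alpha> = 0 then 1 else 0)"
    for \<alpha> :: "'n expo"
    by (auto simp: vec_eq_iff power_0_left)
  show ?thesis
    unfolding eval_poly_def * by (auto simp: if_distrib in_keys_iff cong: if_cong)
qed

definition rvec :: "'n::finite expo \<Rightarrow> real ^ 'n" where
  "rvec \<alpha> = (\<chi> i. real (\<alpha> $ i))"

definition newton :: "'n::finite rpoly \<Rightarrow> (real ^ 'n) set" where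
  "newton p = convex hull (rvec ` Poly_Mapping.keys p)"

definition even_expo :: "'n::finite expo \<Rightarrow> bool" where
  "even_expo \<alpha> \<longleftrightarrow> (\<forall>i. even (\<alpha> $ i))"

definition Delta :: "'n::finite rpoly \<Rightarrow> 'n expo set" where
  "Delta p = {\<alpha>. coeff p \<alpha> < 0 \<or> (\<not> even_expo \<alpha> \<and> coeff p \<alpha> > 0)}"

lemma finite_Delta: "finite (Delta p)"
  by (rule finite_subset[OF _ finite_keys[of p]]) (auto simp: Delta_def in_keys_iff)

text \<open>
  A family \<open>A\<close> stands for the points \<open>\<alpha>(0), \<dots>, \<alpha>(n)\<close>; only its values at indices \<open>\<le> n\<close> matter.
  Barycentric coordinates are set to \<open>0\<close> beyond the index \<open>n\<close> to make them unique as functions.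
\<close>

definition is_bary :: "(nat \<Rightarrow> 'n::finite expo) \<Rightarrow> 'n expo \<Rightarrow> (nat \<Rightarrow> real) \<Rightarrow> bool" where
  "is_bary A \<alpha> l \<longleftrightarrow>
     (\<forall>j\<le>CARD('n). 0 \<le> l j) \<and> (\<Sum>j\<le>CARD('n). l j) = 1 \<and>
     rvec \<alpha> = (\<Sum>j\<le>CARD('n). l j *\<^sub>R rvec (A j)) \<and>
     (\<forall>j>CARD('n). l j = 0)"

definition bary :: "(nat \<Rightarrow> 'n::finite expo) \<Rightarrow> 'n expo \<Rightarrow> nat \<Rightarrow> real" where
  "bary A \<alpha> = (THE l. is_bary A \<alpha> l)"

definition nz :: "(nat \<Rightarrow> 'n::finite expo) \<Rightarrow> 'n expo \<Rightarrow> nat set" where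
  "nz A \<alpha> = {j. j \<le> CARD('n) \<and> bary A \<alpha> j \<noteq> 0}"

definition aff_indep_family :: "(nat \<Rightarrow> 'n::finite expo) \<Rightarrow> bool" where
  "aff_indep_family A \<longleftrightarrow>
     inj_on A {..CARD('n)} \<and> \<not> affine_dependent (rvec ` A ` {..CARD('n)})"

lemma bary_is_bary:
  fixes A :: "nat \<Rightarrow> 'n::finite expo"
  assumes ind: "aff_indep_family A" and mem: "rvec \<alpha> \<in> convex hull (rvec ` A ` {..CARD('n)})"
  shows "is_bary A \<alpha> (bary A \<alpha>)"
proof -
  let ?I = "{..CARD('n)}"
  let ?B = "\<lambda>j. rvec (A j)"
  have rinj: "inj (rvec :: 'n expo \<Rightarrow> real ^ 'n)"
    by (auto simp: inj_def rvec_def vec_eq_iff)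
  have inj: "inj_on ?B ?I"
    using ind rinj by (auto simp: aff_indep_family_def inj_on_def)
  have fin: "finite (?B ` ?I)" by simp
  have ind': "\<not> affine_dependent (?B ` ?I)"
    using ind by (simp add: aff_indep_family_def image_image)
  obtain u where u: "\<forall>x\<in>?B ` ?I. 0 \<le> u x" "sum u (?B ` ?I) = 1"
      "(\<Sum>x\<in>?B ` ?I. u x *\<^sub>R x) = rvec \<alpha>"
    using mem unfolding image_image convex_hull_finite[OF fin] by auto
  let ?l = "\<lambda>j. if j \<le> CARD('n) then u (?B j) else 0"
  have ex: "is_bary A \<alpha> ?l"
    using u by (auto simp: is_bary_def sum.reindex[OF inj])
  have uniq: "l = l'" if l: "is_bary A \<alpha> l" and l': "is_bary A \<alpha> l'" for l l'
  proof (rule ext, rule ccontr)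
    fix j assume ne: "l j \<noteq> l' j"
    then have j: "j \<in> ?I"
      using l l' unfolding is_bary_def by (metis atMost_iff linorder_not_less)
    define U where "U x = (let k = the_inv_into ?I ?B x in l k - l' k)" for x
    have U: "U (?B k) = l k - l' k" if "k \<in> ?I" for k
      using the_inv_into_f_f[OF inj that] by (simp add: U_def)
    have "sum U (?B ` ?I) = 0"
      using l l' by (simp add: sum.reindex[OF inj] U sum_subtractf is_bary_def)
    moreover have "(\<Sum>x\<in>?B ` ?I. U x *\<^sub>R x) = 0"
      using l l' by (simp add: sum.reindex[OF inj] U sum_subtractf is_bary_def scaleR_diff_left)
    moreover have "\<exists>x\<in>?B ` ?I. U x \<noteq> 0"
      using j ne U by force
    ultimately show False
      using ind' affine_dependent_explicit_finite[OF fin] by blast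
  qed
  show ?thesis
    unfolding bary_def by (rule theI[of "is_bary A \<alpha>", OF ex]) (use uniq ex in blast)
qed

definition st_poly :: "(nat \<Rightarrow> 'n::finite expo) \<Rightarrow> 'n rpoly \<Rightarrow> bool" where
  "st_poly A p \<longleftrightarrow>
     p = (\<Sum>j\<le>CARD('n). Poly_Mapping.single (A j) (coeff p (A j)))
         + (\<Sum>\<alpha>\<in>Delta p. Poly_Mapping.single \<alpha> (coeff p \<alpha>)) \<and>
     A 0 = 0 \<and> (\<forall>j\<in>{1..CARD('n)}. even_expo (A j)) \<and> aff_indep_family A \<and>
     rvec ` Delta p \<subseteq> convex hull (rvec ` A ` {..CARD('n)}) \<and>
     (\<forall>j\<le>CARD('n). 0 \<le> coeff p (A j)) \<and>
     (\<forall>j\<le>CARD('n). coeff p (A j) = 0 \<longrightarrow> (\<forall>\<alpha>\<in>Delta p. bary A \<alpha> j = 0))"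

definition gp_feasible ::
    "(nat \<Rightarrow> 'n::finite expo) \<Rightarrow> 'n rpoly \<Rightarrow> real \<Rightarrow> ('n expo \<Rightarrow> nat \<Rightarrow> real) \<Rightarrow> bool" where
  "gp_feasible A p r a \<longleftrightarrow>
     (\<forall>\<alpha>\<in>Delta p. \<forall>j\<in>{1..CARD('n)}. 0 \<le> a \<alpha> j \<and> (0 < bary A \<alpha> j \<longrightarrow> 0 < a \<alpha> j)) \<and>
     (\<forall>\<alpha>\<in>Delta p. bary A \<alpha> 0 = 0 \<longrightarrow>
        \<bar>coeff p \<alpha>\<bar> \<le> (\<Prod>j\<in>nz A \<alpha> \<inter> {1..}. (a \<alpha> j / bary A \<alpha> j) powr (bary A \<alpha> j))) \<and>
     (\<forall>j\<in>{1..CARD('n)}. (\<Sum>\<alpha>\<in>Delta p. a \<alpha> j) \<le> coeff p (A j)) \<and>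
     (\<Sum>\<alpha>\<in>{\<alpha>\<in>Delta p. 0 \<in> nz A \<alpha>}.
         bary A \<alpha> 0 * \<bar>coeff p \<alpha>\<bar> powr (1 / bary A \<alpha> 0) *
         (\<Prod>j\<in>nz A \<alpha> \<inter> {1..}. (bary A \<alpha> j / a \<alpha> j) powr (bary A \<alpha> j / bary A \<alpha> 0)))
       \<le> eval_poly p 0 - r"

definition gp_bound :: "(nat \<Rightarrow> 'n::finite expo) \<Rightarrow> 'n rpoly \<Rightarrow> ereal" where
  "gp_bound A p = (SUP r \<in> {r. \<exists>a. gp_feasible A p r a}. ereal r)"

definition st_simplex :: "(nat \<Rightarrow> 'n::finite expo) \<Rightarrow> 'n rpoly \<Rightarrow> bool" where
  "st_simplex A p \<longleftrightarrow>
     st_poly A p \<and> int CARD('n) simplex newton p \<and>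
     {x. x extreme_point_of newton p} = rvec ` A ` {..CARD('n)}"

text \<open>
  \<open>st_simplex A p\<close> determines \<open>A\<close> up to a permutation of \<open>A 1, \<dots>, A n\<close>, under which the bound
  below and the optimal value of problem (P) are invariant; \<open>vertices\<close> fixes one numbering.
\<close>

definition vertices :: "'n::finite rpoly \<Rightarrow> nat \<Rightarrow> 'n expo" where
  "vertices p = (SOME A. st_simplex A p)"

definition p_gp :: "'n::finite rpoly \<Rightarrow> ereal" where
  "p_gp p = (if \<exists>A. st_simplex A p then gp_bound (vertices p) p else - \<infinity>)"

definition lagr ::
    "nat \<Rightarrow> 'n::finite rpoly \<Rightarrow> (nat \<Rightarrow> 'n rpoly) \<Rightarrow> (nat \<Rightarrow> real) \<Rightarrow> 'n rpoly" where
  "lagr s f g \<mu> = f - (\<Sum>j=1..s. const (\<mu> j) * g j)"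

definition s_bound :: "nat \<Rightarrow> 'n::finite rpoly \<Rightarrow> (nat \<Rightarrow> 'n rpoly) \<Rightarrow> ereal" where
  "s_bound s f g = (SUP \<mu> \<in> {\<mu>. \<forall>j\<in>{1..s}. 0 \<le> \<mu> j}. p_gp (lagr s f g \<mu>))"

definition Delta_all :: "nat \<Rightarrow> 'n::finite rpoly \<Rightarrow> (nat \<Rightarrow> 'n rpoly) \<Rightarrow> 'n expo set" where
  "Delta_all s f g = Delta f \<union> (\<Union>j\<in>{1..s}. Delta (- g j))"

definition Delta_in ::
    "nat \<Rightarrow> 'n::finite rpoly \<Rightarrow> (nat \<Rightarrow> 'n rpoly) \<Rightarrow> (nat \<Rightarrow> real) \<Rightarrow> 'n expo set" where
  "Delta_in s f g \<mu> = {\<alpha>\<in>Delta_all s f g. rvec \<alpha> \<in> newton (lagr s f g \<mu>)}"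

text \<open>
  Problem (P). Expressions involving barycentric coordinates range over \<open>Delta_in\<close>, where those
  coordinates are defined; the sign conditions on the variables \<open>a\<close>, \<open>b\<close> and the
  constraint bounding the sums of the \<open>a \<alpha> j\<close> range over all of \<open>Delta_all\<close>.
\<close>

definition P_objective ::
    "nat \<Rightarrow> 'n::finite rpoly \<Rightarrow> (nat \<Rightarrow> 'n rpoly) \<Rightarrow>
     (nat \<Rightarrow> real) \<Rightarrow> ('n expo \<Rightarrow> nat \<Rightarrow> real) \<Rightarrow> ('n expo \<Rightarrow> real) \<Rightarrow> real" where
  "P_objective s f g \<mu> a b =
     (let A = vertices (lagr s f g \<mu>) in
       (\<Sum>j=1..s. \<mu> j * eval_poly (g j) 0) +
       (\<Sum>\<alpha>\<in>{\<alpha>\<in>Delta_in s f g \<mu>. bary A \<alpha> 0 \<noteq> 0}.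
          bary A \<alpha> 0 * b \<alpha> powr (1 / bary A \<alpha> 0) *
          (\<Prod>j\<in>nz A \<alpha> \<inter> {1..}. (bary A \<alpha> j / a \<alpha> j) powr (bary A \<alpha> j / bary A \<alpha> 0))))"

definition P_feasible ::
    "nat \<Rightarrow> 'n::finite rpoly \<Rightarrow> (nat \<Rightarrow> 'n rpoly) \<Rightarrow>
     (nat \<Rightarrow> real) \<Rightarrow> ('n expo \<Rightarrow> nat \<Rightarrow> real) \<Rightarrow> ('n expo \<Rightarrow> real) \<Rightarrow> bool" where
  "P_feasible s f g \<mu> a b \<longleftrightarrow>
     (let h = lagr s f g \<mu>; A = vertices h in
       (\<forall>j\<in>{1..s}. 0 \<le> \<mu> j) \<and>
       (\<exists>A'. st_simplex A' h) \<and>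
       (\<forall>\<alpha>\<in>Delta_all s f g. (\<forall>j\<in>{1..CARD('n)}. 0 < a \<alpha> j) \<and> 0 \<le> b \<alpha>) \<and>
       (\<forall>j\<in>{1..CARD('n)}. (\<Sum>\<alpha>\<in>Delta_all s f g. a \<alpha> j) \<le> coeff h (A j)) \<and>
       (\<forall>\<alpha>\<in>Delta_in s f g \<mu>. bary A \<alpha> 0 = 0 \<longrightarrow>
          (\<Prod>j\<in>nz A \<alpha> \<inter> {1..}. (a \<alpha> j / bary A \<alpha> j) powr (bary A \<alpha> j)) \<ge> \<bar>coeff h \<alpha>\<bar>) \<and>
       (\<forall>\<alpha>\<in>Delta_in s f g \<mu>. bary A \<alpha> 0 \<noteq> 0 \<longrightarrow> \<bar>coeff h \<alpha>\<bar> \<le> b \<alpha>))"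

definition P_value :: "nat \<Rightarrow> 'n::finite rpoly \<Rightarrow> (nat \<Rightarrow> 'n rpoly) \<Rightarrow> ereal" where
  "P_value s f g =
     (INF (\<mu>, a, b) \<in> {(\<mu>, a, b). P_feasible s f g \<mu> a b}. ereal (P_objective s f g \<mu> a b))"

end

theory Submission
  imports Defs
begin

text \<open>
  The inequality holds feasible point by feasible point: every feasible \<open>(\<mu>, a, b)\<close> of
  problem (P) with value \<open>v\<close> yields a number \<open>r = f(0) - v\<close> that is admissible in the supremum defining the
  geometric-programming bound of the Lagrangian \<open>h(\<mu>)\<close>, with the very same weights \<open>a\<close>
  (\<open>P_feasible_imp_gp_feasible\<close>). Three facts make this work.

  First, \<open>\<Delta>(h(\<mu>)) \<subseteq> \<Delta>(h)\<close>: since \<open>\<mu> \<ge> 0\<close>, a coefficient of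
  \<open>h(\<mu>) = f + \<Sum>\<^sub>j \<mu>\<^sub>j (- g\<^sub>j)\<close> can be negative (positive) only if one of the
  summands has a negative (positive) coefficient there (\<open>Delta_lagr_subset\<close>). So (P) constrains
  at least the exponents that the bound of \<open>h(\<mu>)\<close> cares about.

  Second, the exponents that (P) treats in excess only make (P) more expensive: the budget
  constraints sum the positive \<open>a\<^sub>\<alpha>\<^sub>,\<^sub>j\<close> over a larger set, and the extra terms of the objective
  are nonnegative because barycentric coordinates of points of the Newton simplex are
  (\<open>st_simplex_is_bary\<close>).

  Third, where \<open>\<lambda>\<^sub>0 > 0\<close> the variable \<open>b\<^sub>\<alpha>\<close> dominates \<open>\<bar>h(\<mu>)\<^sub>\<alpha>\<bar>\<close>, and the
  objective is nondecreasing in \<open>b\<^sub>\<alpha>\<close>.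
\<close>

lemma coeff_const_mult: "coeff (const c * p) \<alpha> = c * coeff p \<alpha>"
  by (simp add: mult_map_scale_conv_mult[symmetric] map.rep_eq when_def)

lemma coeff_lagr:
  "coeff (lagr s f g \<mu>) \<alpha> = coeff f \<alpha> - (\<Sum>j=1..s. \<mu> j * coeff (g j) \<alpha>)"
  by (simp add: lagr_def lookup_minus lookup_sum coeff_const_mult)

lemma eval_poly_lagr_0:
  "eval_poly (lagr s f g \<mu>) 0 = eval_poly f 0 - (\<Sum>j=1..s. \<mu> j * eval_poly (g j) 0)"
  by (simp add: eval_poly_0 coeff_lagr)

lemma Delta_lagr_subset:
  assumes \<mu>: "\<forall>j\<in>{1..s}. 0 \<le> \<mu> j"
  shows "Delta (lagr s f g \<mu>) \<subseteq> Delta_all s f g"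
proof
  fix \<alpha> assume \<alpha>: "\<alpha> \<in> Delta (lagr s f g \<mu>)"
  have neg: "coeff f \<alpha> < 0 \<or> (\<exists>j\<in>{1..s}. coeff (g j) \<alpha> > 0)" if "coeff (lagr s f g \<mu>) \<alpha> < 0"
  proof (rule ccontr)
    assume "\<not> ?thesis"
    then have "(\<Sum>j=1..s. \<mu> j * coeff (g j) \<alpha>) \<le> 0" "coeff f \<alpha> \<ge> 0"
      using \<mu> by (auto intro!: sum_nonpos mult_nonneg_nonpos simp: not_less)
    with that show False by (simp add: coeff_lagr)
  qed
  have pos: "coeff f \<alpha> > 0 \<or> (\<exists>j\<in>{1..s}. coeff (g j) \<alpha> < 0)" if "coeff (lagr s f g \<mu>) \<alpha> > 0"
  proof (rule ccontr)
    assume "\<not> ?thesis"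
    then have "(\<Sum>j=1..s. \<mu> j * coeff (g j) \<alpha>) \<ge> 0" "coeff f \<alpha> \<le> 0"
      using \<mu> by (auto intro!: sum_nonneg mult_nonneg_nonneg simp: not_less)
    with that show False by (simp add: coeff_lagr)
  qed
  show "\<alpha> \<in> Delta_all s f g"
    using \<alpha> neg pos by (auto simp: Delta_def Delta_all_def lookup_uminus)
qed

lemma finite_Delta_all: "finite (Delta_all s f g)"
  by (simp add: Delta_all_def finite_Delta)

lemma Delta_lagr_subset_Delta_in:
  assumes "\<forall>j\<in>{1..s}. 0 \<le> \<mu> j"
  shows "Delta (lagr s f g \<mu>) \<subseteq> Delta_in s f g \<mu>"
  using Delta_lagr_subset[OF assms, of f g]
  by (auto simp: Delta_in_def newton_def Delta_def in_keys_iff intro!: hull_inc)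

text \<open>
  A polytope is the convex hull of its extreme points, so every exponent in the Newton polytope,
  even one that does not occur in \<open>p\<close>, has barycentric coordinates.
\<close>

lemma st_simplex_is_bary:
  assumes st: "st_simplex A p" and mem: "rvec \<alpha> \<in> newton p"
  shows "is_bary A \<alpha> (bary A \<alpha>)"
proof (rule bary_is_bary)
  show "aff_indep_family A" using st by (simp add: st_simplex_def st_poly_def)
  have "compact (newton p)" "convex (newton p)"
    unfolding newton_def by (auto intro: finite_imp_compact_convex_hull)
  from Krein_Milman_Minkowski[OF this] st
  show "rvec \<alpha> \<in> convex hull (rvec ` A ` {..CARD('a)})"
    using mem by (simp add: st_simplex_def)
qed

lemma P_feasible_imp_gp_feasible:
  fixes f :: "'n::finite rpoly"
  assumes feas: "P_feasible s f g \<mu> a b"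
  shows "gp_feasible (vertices (lagr s f g \<mu>)) (lagr s f g \<mu>)
           (eval_poly f 0 - P_objective s f g \<mu> a b) a"
proof -
  define h where "h = lagr s f g \<mu>"
  define A where "A = vertices h"
  have \<mu>: "\<forall>j\<in>{1..s}. 0 \<le> \<mu> j" and ex: "\<exists>A'. st_simplex A' h"
    and a: "\<And>\<alpha> j. \<alpha> \<in> Delta_all s f g \<Longrightarrow> j \<in> {1..CARD('n)} \<Longrightarrow> 0 < a \<alpha> j"
    and b: "\<And>\<alpha>. \<alpha> \<in> Delta_all s f g \<Longrightarrow> 0 \<le> b \<alpha>"
    and c1: "\<And>j. j \<in> {1..CARD('n)} \<Longrightarrow> (\<Sum>\<alpha>\<in>Delta_all s f g. a \<alpha> j) \<le> coeff h (A j)"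
    and c2: "\<And>\<alpha>. \<alpha> \<in> Delta_in s f g \<mu> \<Longrightarrow> bary A \<alpha> 0 = 0 \<Longrightarrow>
          \<bar>coeff h \<alpha>\<bar> \<le> (\<Prod>j\<in>nz A \<alpha> \<inter> {1..}. (a \<alpha> j / bary A \<alpha> j) powr (bary A \<alpha> j))"
    and c3: "\<And>\<alpha>. \<alpha> \<in> Delta_in s f g \<mu> \<Longrightarrow> bary A \<alpha> 0 \<noteq> 0 \<Longrightarrow> \<bar>coeff h \<alpha>\<bar> \<le> b \<alpha>"
    using feas by (simp_all add: P_feasible_def Let_def h_def A_def)
  have st: "st_simplex A h"
    unfolding A_def vertices_def using ex by (rule someI_ex)
  have bary_nonneg: "0 \<le> bary A \<alpha> 0" if "\<alpha> \<in> Delta_in s f g \<mu>" for \<alpha>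
    using st_simplex_is_bary[OF st, of \<alpha>] that
    by (simp add: Delta_in_def h_def is_bary_def)
  have sub: "Delta h \<subseteq> Delta_all s f g" "Delta h \<subseteq> Delta_in s f g \<mu>"
    using Delta_lagr_subset[OF \<mu>, of f g] Delta_lagr_subset_Delta_in[OF \<mu>, of f g] by (auto simp: h_def)
  have in_all: "Delta_in s f g \<mu> \<subseteq> Delta_all s f g" by (auto simp: Delta_in_def)
  have budget: "(\<Sum>\<alpha>\<in>Delta h. a \<alpha> j) \<le> coeff h (A j)" if j: "j \<in> {1..CARD('n)}" for j
  proof -
    have "(\<Sum>\<alpha>\<in>Delta h. a \<alpha> j) \<le> (\<Sum>\<alpha>\<in>Delta_all s f g. a \<alpha> j)"
      using a[OF _ j] sub by (intro sum_mono2 finite_Delta_all) (auto simp: less_imp_le)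
    with c1[OF j] show ?thesis by simp
  qed
  define T where "T c \<alpha> = bary A \<alpha> 0 * c \<alpha> powr (1 / bary A \<alpha> 0) *
      (\<Prod>j\<in>nz A \<alpha> \<inter> {1..}. (bary A \<alpha> j / a \<alpha> j) powr (bary A \<alpha> j / bary A \<alpha> 0))"
    for c :: "'n expo \<Rightarrow> real" and \<alpha>
  have "(\<Sum>\<alpha>\<in>{\<alpha>\<in>Delta h. 0 \<in> nz A \<alpha>}. T (\<lambda>\<alpha>. \<bar>coeff h \<alpha>\<bar>) \<alpha>)
      \<le> (\<Sum>\<alpha>\<in>{\<alpha>\<in>Delta h. 0 \<in> nz A \<alpha>}. T b \<alpha>)"
    unfolding T_def using sub c3 bary_nonneg
    by (intro sum_mono mult_right_mono mult_left_mono powr_mono2 prod_nonneg)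
       (auto simp: nz_def)
  also have "\<dots> \<le> (\<Sum>\<alpha>\<in>{\<alpha>\<in>Delta_in s f g \<mu>. bary A \<alpha> 0 \<noteq> 0}. T b \<alpha>)"
    using sub bary_nonneg finite_subset[OF in_all finite_Delta_all]
    by (intro sum_mono2) (auto simp: nz_def T_def intro!: mult_nonneg_nonneg prod_nonneg)
  also have "\<dots> = eval_poly h 0 - (eval_poly f 0 - P_objective s f g \<mu> a b)"
    by (simp add: P_objective_def Let_def T_def h_def A_def eval_poly_lagr_0)
  finally have value_le: "(\<Sum>\<alpha>\<in>{\<alpha>\<in>Delta h. 0 \<in> nz A \<alpha>}. T (\<lambda>\<alpha>. \<bar>coeff h \<alpha>\<bar>) \<alpha>)
      \<le> eval_poly h 0 - (eval_poly f 0 - P_objective s f g \<mu> a b)" .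
  have "gp_feasible A h (eval_poly f 0 - P_objective s f g \<mu> a b) a"
    unfolding gp_feasible_def
    using a c2 sub budget value_le[unfolded T_def] by (auto simp: less_imp_le subset_iff)
  then show ?thesis by (simp only: A_def h_def)
qed

lemma P_feasible_imp_le_s_bound:
  assumes feas: "P_feasible s f g \<mu> a b"
  shows "ereal (eval_poly f 0 - P_objective s f g \<mu> a b) \<le> s_bound s f g"
proof -
  have "ereal (eval_poly f 0 - P_objective s f g \<mu> a b)
      \<le> gp_bound (vertices (lagr s f g \<mu>)) (lagr s f g \<mu>)"
    unfolding gp_bound_def using P_feasible_imp_gp_feasible[OF feas] by (auto intro: SUP_upper)
  also have "\<dots> = p_gp (lagr s f g \<mu>)"
    using feas by (simp add: p_gp_def P_feasible_def Let_def)
  also have "\<dots> \<le> s_bound s f g"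
    unfolding s_bound_def using feas
    by (auto intro!: SUP_upper simp: P_feasible_def Let_def)
  finally show ?thesis .
qed

theorem theorem5p1:
  fixes s :: nat and f :: "'n::finite rpoly" and g :: "nat \<Rightarrow> 'n rpoly"
  shows "ereal (eval_poly f 0) - P_value s f g \<le> s_bound s f g"
proof -
  (* Moving the bound to the other side reduces the claim to a lower bound of an infimum, which
     also covers the infeasible case, where the infimum is infinite. *)
  have "ereal (eval_poly f 0) - s_bound s f g \<le> P_value s f g"
    unfolding P_value_def
  proof (rule INF_greatest, clarify)
    fix \<mu> a b assume "P_feasible s f g \<mu> a b"
    from P_feasible_imp_le_s_bound[OF this]
    show "ereal (eval_poly f 0) - s_bound s f g \<le> ereal (P_objective s f g \<mu> a b)"
      by (cases "s_bound s f g") auto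
  qed
  then show ?thesis
    by (cases "s_bound s f g"; cases "P_value s f g") auto
qed

end
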